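(* Let $\Omega$ be an open subset of $\mathbb{R}^n$, and let $A_+$ and $A_-$ be formally self-adjoint first order linear partial differential operators with smooth coefficients acting on smooth vector functions $\Omega\to\mathbb{C}^m$. For a smooth $u:\Omega\to\mathbb{C}^m$ put $$L_\pm(u):=\operatorname{Re}(u^*A_\pm u),\qquad L(u):=\frac{L_+(u)\,L_-(u)}{L_+(u)-L_-(u)} .$$ Let $u:\Omega\to\mathbb{C}^m$ be a smooth vector function satisfying the condition $L_+(u)\neq L_-(u)$ (at every point of $\Omega$). Then $u$ is a solution of the field equation (Euler--Lagrange equation) for the Lagrangian density $L$ if and only if it is a solution of the equation $A_+u=0$ or the equation $A_-u=0$.
   Context: Vector functions are written as columns of $m$ complex scalars, and $*$ denotes Hermitian conjugation. Smooth means infinitely smooth. Formal self-adjointness (symmetry) is with respect to the inner product $(u,v)=\int_\Omega v^*u\,dx^1\cdots dx^n$, i.e. $(A_\pm u,v)=(u,A_\pm v)$ for all smooth $u,v$ with compact support in $\Omega$. No boundary conditions are imposed. The field equation for a Lagrangian density $L$ is the Euler--Lagrange equation of the action $S(u)=\int_\Omega L(u)\,dx^1\cdots dx^n$: $u$ is a solution if the first variation $\delta\int L(u)=\int_\Omega\frac{d}{dt}\big|_{t=0}L(u+t\,\delta u)\,dx^1\cdots dx^n$ vanishes for every $\delta u\in C_0^\infty(\Omega;\mathbb{C}^m)$. The action integral itself need not converge.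
   Formalization: For disconnected Ω the claim fails as stated, since A₊u=0 may hold on one component and A₋u=0 on another; here the field equation is equivalent to "A₊u=0 or A₋u=0" on each connected component of Ω, and for connected Ω to the alternative on all of Ω. *)

theory Defs
  imports "HOL-Analysis.Analysis"
begin

text \<open>
  Functions on an open set \<open>\<Omega>\<close> are modelled by total functions on \<open>real ^ 'n\<close>;
  their values outside \<open>\<Omega>\<close> are irrelevant. The notions of differentiability below are
  intended for open sets.
\<close>

primrec Ck_on ::
  "nat \<Rightarrow> ('a::euclidean_space \<Rightarrow> 'b::real_normed_vector) \<Rightarrow> 'a set \<Rightarrow> bool" where
  "Ck_on 0 f S \<longleftrightarrow> continuous_on S f"
| "Ck_on (Suc k) f S \<longleftrightarrow>
     (\<forall>x\<in>S. f differentiable (at x)) \<and>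
     (\<forall>v. Ck_on k (\<lambda>x. frechet_derivative f (at x) v) S)"

definition smooth_on ::
  "'a::euclidean_space set \<Rightarrow> ('a \<Rightarrow> 'b::real_normed_vector) \<Rightarrow> bool" where
  "smooth_on S f \<longleftrightarrow> (\<forall>k. Ck_on k f S)"

text \<open>Elements of \<open>C\<^sub>0\<^sup>\<infinity>(\<Omega>)\<close>, extended by zero to the whole space.\<close>

definition test_function ::
  "'a::euclidean_space set \<Rightarrow> ('a \<Rightarrow> 'b::real_normed_vector) \<Rightarrow> bool" where
  "test_function \<Omega> f \<longleftrightarrow>
     smooth_on UNIV f \<and> compact (closure {x. f x \<noteq> 0}) \<and> closure {x. f x \<noteq> 0} \<subseteq> \<Omega>"

definition partial_deriv ::
  "'n::finite \<Rightarrow> (real ^ 'n \<Rightarrow> 'b::real_normed_vector) \<Rightarrow> real ^ 'n \<Rightarrow> 'b" where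
  "partial_deriv j f x = frechet_derivative f (at x) (axis j 1)"

text \<open>
  An operator is only constrained on functions that are smooth on \<open>\<Omega>\<close>, and only at points
  of \<open>\<Omega>\<close>. First order means order at most one: the coefficients \<open>B j\<close> may vanish.
\<close>

definition first_order_diff_op ::
  "(real ^ 'n) set \<Rightarrow>
   ((real ^ 'n \<Rightarrow> complex ^ 'm) \<Rightarrow> (real ^ 'n \<Rightarrow> complex ^ 'm)) \<Rightarrow> bool" where
  "first_order_diff_op \<Omega> A \<longleftrightarrow>
     (\<exists>(B :: 'n \<Rightarrow> real ^ 'n \<Rightarrow> complex ^ 'm ^ 'm) (C :: real ^ 'n \<Rightarrow> complex ^ 'm ^ 'm).
        (\<forall>j. smooth_on \<Omega> (B j)) \<and> smooth_on \<Omega> C \<and>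
        (\<forall>u. smooth_on \<Omega> u \<longrightarrow>
          (\<forall>x\<in>\<Omega>. A u x = (\<Sum>j\<in>UNIV. B j x *v partial_deriv j u x) + C x *v u x)))"

text \<open>The scalar \<open>v\<^sup>*u\<close>, conjugate-linear in the first argument \<open>v\<close>.\<close>

definition hdot :: "complex ^ 'm \<Rightarrow> complex ^ 'm \<Rightarrow> complex" where
  "hdot v u = (\<Sum>i\<in>UNIV. cnj (v $ i) * u $ i)"

definition L2_product ::
  "(real ^ 'n) set \<Rightarrow> (real ^ 'n \<Rightarrow> complex ^ 'm) \<Rightarrow> (real ^ 'n \<Rightarrow> complex ^ 'm) \<Rightarrow> complex" where
  "L2_product \<Omega> u v = (LINT x:\<Omega>|lborel. hdot (v x) (u x))"

definition formally_self_adjoint ::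
  "(real ^ 'n) set \<Rightarrow>
   ((real ^ 'n \<Rightarrow> complex ^ 'm) \<Rightarrow> (real ^ 'n \<Rightarrow> complex ^ 'm)) \<Rightarrow> bool" where
  "formally_self_adjoint \<Omega> A \<longleftrightarrow>
     (\<forall>u v. test_function \<Omega> u \<longrightarrow> test_function \<Omega> v \<longrightarrow>
        L2_product \<Omega> (A u) v = L2_product \<Omega> u (A v))"

definition op_Lagrangian ::
  "((real ^ 'n \<Rightarrow> complex ^ 'm) \<Rightarrow> (real ^ 'n \<Rightarrow> complex ^ 'm)) \<Rightarrow>
   (real ^ 'n \<Rightarrow> complex ^ 'm) \<Rightarrow> real ^ 'n \<Rightarrow> real" where
  "op_Lagrangian A u x = Re (hdot (u x) (A u x))"

definition quotient_Lagrangian ::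
  "((real ^ 'n \<Rightarrow> complex ^ 'm) \<Rightarrow> (real ^ 'n \<Rightarrow> complex ^ 'm)) \<Rightarrow>
   ((real ^ 'n \<Rightarrow> complex ^ 'm) \<Rightarrow> (real ^ 'n \<Rightarrow> complex ^ 'm)) \<Rightarrow>
   (real ^ 'n \<Rightarrow> complex ^ 'm) \<Rightarrow> real ^ 'n \<Rightarrow> real" where
  "quotient_Lagrangian Ap Am u x =
     op_Lagrangian Ap u x * op_Lagrangian Am u x / (op_Lagrangian Ap u x - op_Lagrangian Am u x)"

text \<open>
  Since \<open>deriv\<close> and the Lebesgue integral are total, pointwise existence of the derivative
  and integrability are required explicitly: the first variation must exist and be zero.
\<close>

definition variation_density ::
  "((real ^ 'n \<Rightarrow> complex ^ 'm) \<Rightarrow> real ^ 'n \<Rightarrow> real) \<Rightarrow>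
   (real ^ 'n \<Rightarrow> complex ^ 'm) \<Rightarrow> (real ^ 'n \<Rightarrow> complex ^ 'm) \<Rightarrow> real ^ 'n \<Rightarrow> real" where
  "variation_density L u \<phi> x = deriv (\<lambda>t::real. L (\<lambda>y. u y + t *\<^sub>R \<phi> y) x) 0"

definition Euler_Lagrange_solution ::
  "(real ^ 'n) set \<Rightarrow> ((real ^ 'n \<Rightarrow> complex ^ 'm) \<Rightarrow> real ^ 'n \<Rightarrow> real) \<Rightarrow>
   (real ^ 'n \<Rightarrow> complex ^ 'm) \<Rightarrow> bool" where
  "Euler_Lagrange_solution \<Omega> L u \<longleftrightarrow>
     (\<forall>\<phi>. test_function \<Omega> \<phi> \<longrightarrow>
        (\<forall>x\<in>\<Omega>. (\<lambda>t::real. L (\<lambda>y. u y + t *\<^sub>R \<phi> y) x) differentiable (at 0)) \<and>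
        set_integrable lborel \<Omega> (variation_density L u \<phi>) \<and>
        (LINT x:\<Omega>|lborel. variation_density L u \<phi> x) = 0)"

text \<open>
  Solving is relative to a set, since on a disconnected \<open>\<Omega>\<close> the alternative
  \<open>A\<^sub>+u = 0\<close> or \<open>A\<^sub>-u = 0\<close> may be realised differently on different components.
  For example, for \<open>n = m = 1\<close> and \<open>u = 1\<close>, take \<open>i d/dx\<close> on one interval and
  \<open>i d/dx + 1\<close> on another as \<open>A\<^sub>+\<close>, and the other way round as \<open>A\<^sub>-\<close>.
\<close>

definition solves_on ::
  "(real ^ 'n) set \<Rightarrow>
   ((real ^ 'n \<Rightarrow> complex ^ 'm) \<Rightarrow> (real ^ 'n \<Rightarrow> complex ^ 'm)) \<Rightarrow>
   (real ^ 'n \<Rightarrow> complex ^ 'm) \<Rightarrow> bool" where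
  "solves_on S A u \<longleftrightarrow> (\<forall>x\<in>S. A u x = 0)"

end

theory Submission
  imports Defs
begin

text \<open>
  For \<open>\<delta>u = h u\<close> with \<open>h\<close> real, symmetry of \<open>A\<^sub>\<plusminus>\<close> kills the terms containing derivatives of \<open>h\<close>,
  so the first variation is the integral of \<open>2 h L\<close>; stationarity thus forces \<open>L = 0\<close>, that is,
  \<open>L\<^sub>+ L\<^sub>- = 0\<close>. Since \<open>L\<^sub>+ \<noteq> L\<^sub>-\<close>, the zero sets of \<open>L\<^sub>+\<close> and \<open>L\<^sub>-\<close> are disjoint open sets covering
  \<open>\<Omega>\<close>. On the first one the differential of \<open>L\<close> is \<open>- dL\<^sub>+\<close>, on the second one \<open>dL\<^sub>-\<close>, so there
  the field equation reduces to \<open>A\<^sub>+ u = 0\<close> and \<open>A\<^sub>- u = 0\<close> respectively.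
\<close>

section \<open>Smooth functions\<close>

text \<open>The factor 2 is Euler's identity: each of the two Lagrangians is quadratic in
  \<open>u\<close>, and \<open>L\<close> is homogeneous of degree one in the pair, so a multiplier
  \<open>h\<close> that varies both like a constant varies \<open>L\<close> by \<open>2 h L\<close>.
  That derivatives of \<open>h\<close> drop out is shown without integrating by parts and without
  extracting relations between the coefficients. The commutator of \<open>A\<close> with
  \<open>h\<close> is multiplication by a matrix, and symmetry is tested on real multiples
  \<open>f u\<close>. Since \<open>f\<close> enters twice, the integrals carry its square, hence a
  fundamental lemma for squares of test functions. Symmetry is given for pairs of test functions,
  whereas \<open>u\<close> is merely smooth on \<open>\<Omega>\<close>. As \<open>A\<close> is
  local, \<open>u\<close> may be replaced by a cut-off copy that agrees with it near the support of
  the variation. Analytically the field equation is equivalent to an alternative at each point. That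
  the choice is constant on a connected set is a separate topological step.\<close>

lemma Ck_on_cong:
  fixes f g :: "'a::euclidean_space \<Rightarrow> 'b::real_normed_vector"
  assumes "open S" "\<And>x. x \<in> S \<Longrightarrow> f x = g x" "Ck_on k f S"
  shows "Ck_on k g S"
  using assms(2,3)
proof (induction k arbitrary: f g)
  case 0
  then show ?case by (simp cong: continuous_on_cong)
next
  case (Suc k)
  have d: "(g has_derivative frechet_derivative f (at x)) (at x)" if "x \<in> S" for x
  proof (rule has_derivative_transform_within_open[OF _ \<open>open S\<close> that])
    show "(f has_derivative frechet_derivative f (at x)) (at x)"
      using Suc.prems(2) that by (simp add: frechet_derivative_works)
  qed (use Suc.prems(1) in auto)
  then have eq: "frechet_derivative f (at x) = frechet_derivative g (at x)" if "x \<in> S" for x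
    using frechet_derivative_at that by blast
  show ?case
    unfolding Ck_on.simps
  proof (intro conjI ballI allI)
    show "g differentiable at x" if "x \<in> S" for x
      using d[OF that] by (auto simp: differentiable_def)
    show "Ck_on k (\<lambda>x. frechet_derivative g (at x) v) S" for v
      by (rule Suc.IH[of "\<lambda>x. frechet_derivative f (at x) v"]) (use eq Suc.prems(2) in auto)
  qed
qed

text \<open>By uniqueness of the derivative, any explicit formula can stand for the
  \<open>frechet_derivative\<close> in the recursion. The inductions for sums, products, inverses
  and \<open>flat_exp\<close> all go through this rule.\<close>

lemma Ck_on_Suc_derivative:
  fixes f :: "'a::euclidean_space \<Rightarrow> 'b::real_normed_vector"
  assumes "open S" "\<And>x. x \<in> S \<Longrightarrow> (f has_derivative f' x) (at x)"
    and "\<And>v. Ck_on k (\<lambda>x. f' x v) S"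
  shows "Ck_on (Suc k) f S"
  unfolding Ck_on.simps
proof (intro conjI ballI allI)
  show "f differentiable at x" if "x \<in> S" for x
    using assms(2)[OF that] by (auto simp: differentiable_def)
  have "f' x = frechet_derivative f (at x)" if "x \<in> S" for x
    using assms(2)[OF that] by (rule frechet_derivative_at)
  then show "Ck_on k (\<lambda>x. frechet_derivative f (at x) v) S" for v
    by (intro Ck_on_cong[OF assms(1) _ assms(3)[of v]]) auto
qed

lemma Ck_on_SucD_derivative:
  assumes "Ck_on (Suc k) f S" "x \<in> S"
  shows "(f has_derivative frechet_derivative f (at x)) (at x)"
  using assms by (simp add: frechet_derivative_works)

lemma Ck_on_SucD:
  assumes "Ck_on (Suc k) f S"
  shows "Ck_on k f S"
  using assms
proof (induction k arbitrary: f)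
  case 0
  then show ?case
    by (auto intro!: continuous_at_imp_continuous_on differentiable_imp_continuous_within)
next
  case (Suc k)
  then show ?case
    by (metis Ck_on.simps(2))
qed

lemma Ck_on_const: "Ck_on k (\<lambda>x::'a::euclidean_space. c::'b::real_normed_vector) S"
  by (induction k arbitrary: c) simp_all

lemma Ck_on_id: "Ck_on k (\<lambda>x::'a::euclidean_space. x) S"
proof (cases k)
  case (Suc l)
  have "frechet_derivative (\<lambda>x::'a. x) (at x) = (\<lambda>v. v)" for x
    by (metis frechet_derivative_at has_derivative_ident)
  then show ?thesis
    using Suc by (simp add: Ck_on_const)
qed simp

lemma Ck_on_add:
  assumes "open S" "Ck_on k f S" "Ck_on k g S"
  shows "Ck_on k (\<lambda>x. f x + g x) S"
  using assms(2,3)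
proof (induction k arbitrary: f g)
  case 0
  then show ?case by (simp add: continuous_on_add)
next
  case (Suc k)
  show ?case
  proof (rule Ck_on_Suc_derivative[OF \<open>open S\<close>])
    show "((\<lambda>x. f x + g x) has_derivative
      (\<lambda>v. frechet_derivative f (at x) v + frechet_derivative g (at x) v)) (at x)" if "x \<in> S" for x
      using Suc.prems that by (intro has_derivative_add Ck_on_SucD_derivative)
  qed (use Suc in simp)
qed

text \<open>The product rule yields two terms of the same bilinear shape, one order lower, so the
  induction closes. A general \<open>p\<close> covers scalar multiples, products and inner products
  at once.\<close>

lemma Ck_on_bilinear:
  assumes "bounded_bilinear p" and "open S" "Ck_on k f S" "Ck_on k g S"
  shows "Ck_on k (\<lambda>x. p (f x) (g x)) S"
  using assms(3,4)
proof (induction k arbitrary: f g)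
  case 0
  then show ?case
    using bounded_bilinear.continuous_on[OF assms(1)] by simp
next
  case (Suc k)
  show ?case
  proof (rule Ck_on_Suc_derivative[OF \<open>open S\<close>])
    show "((\<lambda>x. p (f x) (g x)) has_derivative
      (\<lambda>v. p (f x) (frechet_derivative g (at x) v) + p (frechet_derivative f (at x) v) (g x))) (at x)"
      if "x \<in> S" for x
      by (rule bounded_bilinear.FDERIV[OF assms(1)])
        (use Suc.prems that in \<open>auto intro: Ck_on_SucD_derivative\<close>)
    show "Ck_on k (\<lambda>x. p (f x) (frechet_derivative g (at x) v)
        + p (frechet_derivative f (at x) v) (g x)) S" for v
      using Suc.prems by (intro Ck_on_add[OF \<open>open S\<close>] Suc.IH) (auto intro: Ck_on_SucD)
  qed
qed

text \<open>The derivative of \<open>1/f\<close> is a product of \<open>f'\<close> with two copies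
  of \<open>1/f\<close>, to which the induction hypothesis applies.\<close>

lemma Ck_on_inverse:
  fixes f :: "'a::euclidean_space \<Rightarrow> real"
  assumes "open S" "Ck_on k f S" "\<And>x. x \<in> S \<Longrightarrow> f x \<noteq> 0"
  shows "Ck_on k (\<lambda>x. inverse (f x)) S"
  using assms(2)
proof (induction k)
  case 0
  then show ?case using assms(3) by (auto intro: continuous_on_inverse)
next
  case (Suc k)
  note mult = Ck_on_bilinear[OF bounded_bilinear_mult \<open>open S\<close>]
  show ?case
  proof (rule Ck_on_Suc_derivative[OF \<open>open S\<close>])
    show "((\<lambda>x. inverse (f x)) has_derivative
      (\<lambda>v. (-1) * (inverse (f x) * frechet_derivative f (at x) v * inverse (f x)))) (at x)"
      if "x \<in> S" for x
      using DERIV_compose_FDERIV[OF DERIV_inverse[OF assms(3)[OF that]]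
          Ck_on_SucD_derivative[OF Suc.prems that]]
      by (simp add: power2_eq_square mult_ac)
    show "Ck_on k (\<lambda>x. (-1) * (inverse (f x) * frechet_derivative f (at x) v * inverse (f x))) S"
      for v
      using Suc Ck_on_SucD[OF Suc.prems] by (intro mult Ck_on_const) auto
  qed
qed

text \<open>The gluing principle behind extension by zero: a function is smooth everywhere if it is
  smooth on \<open>\<Omega>\<close> and on the complement of a compact subset of
  \<open>\<Omega>\<close>.\<close>

lemma Ck_on_Un:
  fixes f :: "'a::euclidean_space \<Rightarrow> 'b::real_normed_vector"
  assumes "open S" "open T" "Ck_on k f S" "Ck_on k f T"
  shows "Ck_on k f (S \<union> T)"
  using assms(3,4)
proof (induction k arbitrary: f)
  case 0
  then show ?case by (simp add: assms(1,2) continuous_on_open_Un)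
qed auto

lemma Ck_on_subset: "Ck_on k f S \<Longrightarrow> T \<subseteq> S \<Longrightarrow> Ck_on k f T"
proof (induction k arbitrary: f)
  case 0
  then show ?case by (auto intro: continuous_on_subset)
qed auto

lemma smooth_on_const [simp]: "smooth_on S (\<lambda>x. c)"
  by (simp add: smooth_on_def Ck_on_const)

lemma smooth_on_id: "smooth_on S (\<lambda>x. x)"
  by (simp add: smooth_on_def Ck_on_id)

lemma smooth_on_add:
  "open S \<Longrightarrow> smooth_on S f \<Longrightarrow> smooth_on S g \<Longrightarrow> smooth_on S (\<lambda>x. f x + g x)"
  by (simp add: smooth_on_def Ck_on_add)

lemma smooth_on_bilinear:
  assumes "bounded_bilinear p" "open S" "smooth_on S f" "smooth_on S g"
  shows "smooth_on S (\<lambda>x. p (f x) (g x))"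
  using assms by (simp add: smooth_on_def Ck_on_bilinear)

lemmas smooth_on_scaleR = smooth_on_bilinear[OF bounded_bilinear_scaleR]
lemmas smooth_on_mult = smooth_on_bilinear[OF bounded_bilinear_mult]
lemmas smooth_on_inner = smooth_on_bilinear[OF bounded_bilinear_inner]

lemma smooth_on_diff:
  assumes "open S" "smooth_on S f" "smooth_on S g"
  shows "smooth_on S (\<lambda>x. f x - g x)"
proof -
  have "smooth_on S (\<lambda>x. f x + (-1) *\<^sub>R g x)"
    by (intro smooth_on_add smooth_on_scaleR assms smooth_on_const)
  then show ?thesis by simp
qed

lemma smooth_on_inverse:
  fixes f :: "'a::euclidean_space \<Rightarrow> real"
  shows "open S \<Longrightarrow> smooth_on S f \<Longrightarrow> (\<And>x. x \<in> S \<Longrightarrow> f x \<noteq> 0) \<Longrightarrow> smooth_on S (\<lambda>x. inverse (f x))"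
  by (simp add: smooth_on_def Ck_on_inverse)

lemma smooth_on_cong:
  "open S \<Longrightarrow> smooth_on S f \<Longrightarrow> (\<And>x. x \<in> S \<Longrightarrow> f x = g x) \<Longrightarrow> smooth_on S g"
  unfolding smooth_on_def using Ck_on_cong by blast

lemma smooth_on_Un: "open S \<Longrightarrow> open T \<Longrightarrow> smooth_on S f \<Longrightarrow> smooth_on T f \<Longrightarrow> smooth_on (S \<union> T) f"
  by (simp add: smooth_on_def Ck_on_Un)

lemma smooth_on_subset: "smooth_on S f \<Longrightarrow> T \<subseteq> S \<Longrightarrow> smooth_on T f"
  unfolding smooth_on_def using Ck_on_subset by blast

lemma smooth_on_sum:
  assumes "open S" "finite I" "\<And>i. i \<in> I \<Longrightarrow> smooth_on S (f i)"
  shows "smooth_on S (\<lambda>x. \<Sum>i\<in>I. f i x)"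
  using assms(2,3) by (induction rule: finite_induct) (auto intro: smooth_on_add[OF assms(1)])

lemma smooth_on_imp_continuous_on: "smooth_on S f \<Longrightarrow> continuous_on S f"
  unfolding smooth_on_def by (metis Ck_on.simps(1))

lemma smooth_on_has_derivative:
  "smooth_on S f \<Longrightarrow> x \<in> S \<Longrightarrow> (f has_derivative frechet_derivative f (at x)) (at x)"
  unfolding smooth_on_def using Ck_on_SucD_derivative by blast

lemma smooth_on_continuous_partial_deriv:
  assumes "smooth_on S f"
  shows "continuous_on S (partial_deriv j f)"
proof -
  have "Ck_on (Suc 0) f S" using assms by (simp add: smooth_on_def)
  then show ?thesis by (simp add: partial_deriv_def[abs_def])
qed

section \<open>Cutoff functions\<close>

text \<open>The powers of \<open>1/t\<close> make the family closed under differentiation, so that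
  smoothness of the classical flat function \<open>flat_exp 0\<close> becomes an induction over the
  whole family.\<close>

definition flat_exp :: "nat \<Rightarrow> real \<Rightarrow> real" where
  "flat_exp k t = (if t > 0 then exp (- inverse t) * inverse t ^ k else 0)"

lemma flat_exp_nonneg [simp]: "0 \<le> flat_exp k t"
  by (simp add: flat_exp_def)

lemma flat_exp_pos_iff [simp]: "0 < flat_exp k t \<longleftrightarrow> 0 < t"
  by (simp add: flat_exp_def)

lemma flat_exp_eq_0_iff [simp]: "flat_exp k t = 0 \<longleftrightarrow> t \<le> 0"
  by (simp add: flat_exp_def)

lemma flat_exp_0 [simp]: "flat_exp k 0 = 0"
  by simp

text \<open>With \<open>s = 1/t\<close> the limit from the right is that of
  \<open>s ^ k / exp s\<close> at infinity.\<close>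

lemma flat_exp_tendsto_0: "(flat_exp k \<longlongrightarrow> 0) (at 0)"
proof -
  have "((\<lambda>t::real. exp (- inverse t) * inverse t ^ k) \<longlongrightarrow> 0) (at_right 0)"
  proof -
    have "((\<lambda>x::real. x ^ k / exp x) \<longlongrightarrow> 0) at_top"
      by (rule tendsto_power_div_exp_0)
    from filterlim_compose[OF this filterlim_inverse_at_top_right]
    show ?thesis by (simp add: exp_minus field_simps)
  qed
  then have "(flat_exp k \<longlongrightarrow> 0) (at_right 0)"
    by (rule Lim_transform_eventually)
      (auto simp: flat_exp_def eventually_at_filter)
  moreover have "(flat_exp k \<longlongrightarrow> 0) (at_left 0)"
    by (rule Lim_transform_eventually[OF tendsto_const])
      (auto simp: flat_exp_def eventually_at_filter)
  ultimately show ?thesis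
    by (simp add: filterlim_split_at)
qed

lemma flat_exp_has_derivative:
  "(flat_exp k has_real_derivative (flat_exp (k + 2) t - real k * flat_exp (k + 1) t)) (at t)"
proof -
  consider "t > 0" | "t < 0" | "t = 0" by linarith
  then show ?thesis
  proof cases
    case 1
    have "((\<lambda>t. inverse t ^ k) has_real_derivative - real k * inverse t ^ (k + 1)) (at t)"
    proof (rule DERIV_cong)
      show "((\<lambda>t. inverse t ^ k) has_real_derivative
          real k * (- (inverse t ^ Suc (Suc 0)) * inverse t ^ (k - Suc 0))) (at t)"
        using 1 by (intro DERIV_power DERIV_inverse) simp
    \<comment> \<open>For \<open>k = 0\<close> the exponent \<open>k - Suc 0\<close> is truncated to
      0, which is harmless because of the factor \<open>real k\<close>.\<close>
    qed (cases k; simp add: algebra_simps)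
    moreover have "((\<lambda>t. exp (- inverse t)) has_real_derivative
        exp (- inverse t) * inverse t ^ 2) (at t)"
      using 1 by (auto intro!: derivative_eq_intros simp: power2_eq_square)
    ultimately have "((\<lambda>t. exp (- inverse t) * inverse t ^ k) has_real_derivative
        exp (- inverse t) * inverse t ^ 2 * inverse t ^ k +
        - real k * inverse t ^ (k + 1) * exp (- inverse t)) (at t)"
      by (intro DERIV_mult)
    then have "((\<lambda>t. exp (- inverse t) * inverse t ^ k) has_real_derivative
        (flat_exp (k + 2) t - real k * flat_exp (k + 1) t)) (at t)"
      by (rule DERIV_cong)
        (use 1 in \<open>simp add: flat_exp_def power2_eq_square algebra_simps\<close>)
    then show ?thesis
      by (rule has_field_derivative_transform_within_open[where S = "{0<..}"])
        (use 1 in \<open>auto simp: flat_exp_def\<close>)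
  next
    case 2
    have "((\<lambda>t. 0) has_real_derivative (flat_exp (k + 2) t - real k * flat_exp (k + 1) t)) (at t)"
      using 2 by (simp add: flat_exp_def)
    then show ?thesis
      by (rule has_field_derivative_transform_within_open[where S = "{..<0}"])
        (use 2 in \<open>auto simp: flat_exp_def\<close>)
  next
    case 3
    \<comment> \<open>The difference quotient at 0 is again a member of the family, so its limit is
      already known.\<close>
    have "flat_exp k h / h = flat_exp (Suc k) h" for h
      by (simp add: flat_exp_def field_simps)
    then show ?thesis
      using 3 flat_exp_tendsto_0[of "Suc k"] by (simp add: DERIV_def)
  qed
qed

text \<open>The chain rule replaces index \<open>k\<close> by \<open>k + 1\<close> and
  \<open>k + 2\<close>; hence the induction on the order keeps \<open>k\<close> arbitrary.\<close>

lemma Ck_on_flat_exp: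
  assumes "open S" "\<And>j. Ck_on j q S"
  shows "Ck_on n (\<lambda>x. flat_exp k (q x)) S"
proof (induction n arbitrary: k)
  case 0
  have "isCont (flat_exp k) t" for t
    using flat_exp_has_derivative by (rule DERIV_isCont)
  moreover have "continuous_on S q" using assms(2)[of 0] by simp
  ultimately show ?case
    by (auto intro: continuous_on_compose2[of UNIV] continuous_at_imp_continuous_on)
next
  case (Suc n)
  note mult = Ck_on_bilinear[OF bounded_bilinear_mult assms(1)]
  have q: "Ck_on (Suc j) q S" for j by (rule assms(2))
  show ?case
  proof (rule Ck_on_Suc_derivative[OF assms(1)])
    fix x assume "x \<in> S"
    then have "(q has_derivative frechet_derivative q (at x)) (at x)"
      using q by (rule Ck_on_SucD_derivative[rotated])
    from DERIV_compose_FDERIV[OF flat_exp_has_derivative this]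
    show "((\<lambda>x. flat_exp k (q x)) has_derivative (\<lambda>v. frechet_derivative q (at x) v *
        (flat_exp (k + 2) (q x) + (- real k) * flat_exp (k + 1) (q x)))) (at x)"
      by simp
  next
    fix v
    show "Ck_on n (\<lambda>x. frechet_derivative q (at x) v *
        (flat_exp (k + 2) (q x) + (- real k) * flat_exp (k + 1) (q x))) S"
      using q[of n] by (intro mult Ck_on_add[OF assms(1)] Ck_on_const Suc.IH) simp
  qed
qed

lemma smooth_on_flat_exp: "open S \<Longrightarrow> smooth_on S q \<Longrightarrow> smooth_on S (\<lambda>x. flat_exp k (q x))"
  by (simp add: smooth_on_def Ck_on_flat_exp)

section \<open>Test functions: supports, products, restrictions, bumps and cutoffs\<close>

lemma test_function_imp_smooth_on: "test_function \<Omega> f \<Longrightarrow> smooth_on S f"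
  unfolding test_function_def using smooth_on_subset by blast

lemma test_function_mono: "test_function \<Omega> f \<Longrightarrow> \<Omega> \<subseteq> \<Omega>' \<Longrightarrow> test_function \<Omega>' f"
  unfolding test_function_def by blast

lemma test_functionI:
  assumes "smooth_on UNIV f" "compact K" "K \<subseteq> \<Omega>" "\<And>x. x \<notin> K \<Longrightarrow> f x = 0"
  shows "test_function \<Omega> f"
proof -
  have "closure {x. f x \<noteq> 0} \<subseteq> K"
    using assms by (intro closure_minimal) (auto intro: compact_imp_closed)
  moreover from this have "compact (closure {x. f x \<noteq> 0})"
    using assms(2) by (metis closed_closure compact_Int_closed inf.absorb_iff2)
  ultimately show ?thesis using assms unfolding test_function_def by auto
qed

lemma test_function_compact_support:
  assumes "test_function \<Omega> f"
  obtains K where "compact K" "K \<subseteq> \<Omega>" "\<And>x. x \<notin> K \<Longrightarrow> f x = 0"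
proof
  show "f x = 0" if "x \<notin> closure {x. f x \<noteq> 0}" for x
    using that closure_subset[of "{x. f x \<noteq> 0}"] by blast
qed (use assms in \<open>auto simp: test_function_def\<close>)

text \<open>Outside \<open>\<Omega>\<close> the values of \<open>u\<close> are arbitrary, but the
  product vanishes off the compact support \<open>K\<close> of \<open>h\<close>; the open sets
  \<open>\<Omega>\<close> and \<open>- K\<close> cover the space, and the product is smooth on
  each.\<close>

lemma test_function_scaleR:
  fixes u :: "'a::euclidean_space \<Rightarrow> 'b::real_normed_vector"
  assumes "open \<Omega>" "test_function \<Omega> h" "smooth_on \<Omega> u"
  shows "test_function \<Omega> (\<lambda>x. h x *\<^sub>R u x)"
proof -
  obtain K where K: "compact K" "K \<subseteq> \<Omega>" "\<And>x. x \<notin> K \<Longrightarrow> h x = 0"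
    using test_function_compact_support[OF assms(2)] by blast
  have o: "open (- K)" using K(1) by (simp add: compact_imp_closed open_Compl)
  have "smooth_on (- K) (\<lambda>x. h x *\<^sub>R u x)"
    by (rule smooth_on_cong[OF o smooth_on_const[of _ 0]]) (use K in auto)
  moreover have "smooth_on \<Omega> (\<lambda>x. h x *\<^sub>R u x)"
    by (intro smooth_on_scaleR assms test_function_imp_smooth_on[OF assms(2)])
  ultimately have "smooth_on (\<Omega> \<union> - K) (\<lambda>x. h x *\<^sub>R u x)"
    by (rule smooth_on_Un[OF assms(1) o, rotated])
  moreover have "\<Omega> \<union> - K = UNIV" using K by auto
  ultimately show ?thesis
    using K by (intro test_functionI[where K = K]) auto
qed

text \<open>Cutting at the boundary of \<open>S\<close> creates no jump: the support lies in two
  disjoint open sets, so its part in \<open>S\<close> equals its part outside \<open>T\<close> and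
  is compact.\<close>

lemma test_function_restrict:
  fixes f :: "'a::euclidean_space \<Rightarrow> 'b::real_normed_vector"
  assumes "test_function (S \<union> T) f" "open S" "open T" "S \<inter> T = {}"
  shows "test_function S (\<lambda>x. if x \<in> S then f x else 0)"
proof -
  obtain K where K: "compact K" "K \<subseteq> S \<union> T" "\<And>x. x \<notin> K \<Longrightarrow> f x = 0"
    using test_function_compact_support[OF assms(1)] by blast
  have o: "open (- K \<union> T)" using K(1) assms by (simp add: compact_imp_closed open_Compl open_Un)
  have "smooth_on (- K \<union> T) (\<lambda>x. if x \<in> S then f x else 0)"
    by (rule smooth_on_cong[OF o smooth_on_const[of _ 0]]) (use K assms in auto)
  moreover have "smooth_on S (\<lambda>x. if x \<in> S then f x else 0)"
    by (rule smooth_on_cong[OF assms(2) test_function_imp_smooth_on[OF assms(1)]]) auto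
  ultimately have "smooth_on (S \<union> (- K \<union> T)) (\<lambda>x. if x \<in> S then f x else 0)"
    by (rule smooth_on_Un[OF assms(2) o, rotated])
  moreover have "S \<union> (- K \<union> T) = UNIV" using K by auto
  moreover have "compact (K \<inter> S)"
  proof -
    have "K \<inter> S = K \<inter> - T" using K assms by auto
    then show ?thesis using K(1) assms(3) by (metis closed_Compl compact_Int_closed)
  qed
  ultimately show ?thesis
    using K by (intro test_functionI[where K = "K \<inter> S"]) auto
qed

lemma bump_function:
  fixes a :: "'a::euclidean_space"
  assumes "cball a r \<subseteq> \<Omega>"
  obtains h :: "'a \<Rightarrow> real" where "test_function \<Omega> h" "\<And>x. 0 \<le> h x"
    "\<And>x. 0 < h x \<longleftrightarrow> x \<in> ball a r"
proof (cases "0 < r")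
  case True
  \<comment> \<open>Writing the squared distance as an inner product keeps the argument smooth at
    the centre \<open>a\<close> too.\<close>
  define h where "h x = flat_exp 0 (r\<^sup>2 - (x - a) \<bullet> (x - a))" for x
  have pos: "0 < h x \<longleftrightarrow> x \<in> ball a r" for x
  proof -
    have "0 < h x \<longleftrightarrow> (norm (x - a))\<^sup>2 < r\<^sup>2"
      by (simp add: h_def power2_norm_eq_inner)
    also have "\<dots> \<longleftrightarrow> norm (x - a) < r"
      using True by (metis norm_ge_zero less_imp_le power2_less_imp_less power_strict_mono pos2)
    finally show ?thesis by (simp add: dist_norm norm_minus_commute)
  qed
  have nonneg: "0 \<le> h x" for x by (simp add: h_def)
  have "smooth_on UNIV h"
    unfolding h_def[abs_def]
    by (intro smooth_on_flat_exp smooth_on_diff smooth_on_inner smooth_on_const smooth_on_id open_UNIV)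
  then have "test_function \<Omega> h"
  proof (rule test_functionI[where K = "cball a r"])
    show "h x = 0" if "x \<notin> cball a r" for x
      using that pos[of x] nonneg[of x] by (auto simp: less_le)
  qed (use assms in auto)
  then show ?thesis using that pos nonneg by blast
next
  case False
  have "test_function \<Omega> (\<lambda>x::'a. 0::real)" by (simp add: test_function_def)
  then show ?thesis using that[of "\<lambda>x. 0"] False by (auto simp: ball_empty)
qed

text \<open>The value 1 is needed on a neighbourhood of \<open>K\<close>, so that first derivatives
  of \<open>h u\<close> and \<open>u\<close> also agree on \<open>K\<close>. The sum
  \<open>s\<close> of finitely many bumps is positive on \<open>K\<close>; a smooth step function of
  \<open>s\<close> then levels it off.\<close>

lemma cutoff_function:
  fixes K :: "'a::euclidean_space set"
  assumes "compact K" "open \<Omega>" "K \<subseteq> \<Omega>"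
  obtains h :: "'a \<Rightarrow> real" and N where "test_function \<Omega> h" "open N" "K \<subseteq> N"
    "\<And>x. x \<in> N \<Longrightarrow> h x = 1"
proof (cases "K = {}")
  case True
  have "test_function \<Omega> (\<lambda>x::'a. 0::real)" by (simp add: test_function_def)
  then show ?thesis using that[of "\<lambda>x. 0" "{}"] True by auto
next
  case False
  have "\<exists>r>0. cball x r \<subseteq> \<Omega>" if "x \<in> K" for x
    using assms that open_contains_cball by blast
  then obtain r where r: "\<And>x. x \<in> K \<Longrightarrow> 0 < r x" "\<And>x. x \<in> K \<Longrightarrow> cball x (r x) \<subseteq> \<Omega>"
    by metis
  have "K \<subseteq> (\<Union>a\<in>K. ball a (r a))" using r(1) by force
  then obtain I where I: "I \<subseteq> K" "finite I" "K \<subseteq> (\<Union>a\<in>I. ball a (r a))"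
    using compactE_image[OF assms(1), of K "\<lambda>a. ball a (r a)"] open_ball by blast
  have "\<exists>h. test_function \<Omega> h \<and> (\<forall>x. 0 \<le> (h x :: real)) \<and> (\<forall>x. 0 < h x \<longleftrightarrow> x \<in> ball a (r a))"
    if "a \<in> I" for a
    using bump_function[of a "r a" \<Omega>] r(2) I(1) that by (metis subsetD)
  then obtain b :: "'a \<Rightarrow> 'a \<Rightarrow> real" where b: "\<And>a. a \<in> I \<Longrightarrow> test_function \<Omega> (b a)"
    "\<And>a x. a \<in> I \<Longrightarrow> 0 \<le> b a x" "\<And>a x. a \<in> I \<Longrightarrow> 0 < b a x \<longleftrightarrow> x \<in> ball a (r a)"
    by metis
  define s where "s x = (\<Sum>a\<in>I. b a x)" for x
  have smooth_s: "smooth_on S s" for S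
    by (rule smooth_on_subset[OF _ subset_UNIV], unfold s_def[abs_def],
        rule smooth_on_sum) (use I b in \<open>auto intro: test_function_imp_smooth_on\<close>)
  have cont_s: "continuous_on S s" for S
    by (rule smooth_on_imp_continuous_on[OF smooth_s])
  have s_pos: "0 < s x" if "x \<in> K" for x
  proof -
    obtain a where "a \<in> I" "x \<in> ball a (r a)" using I(3) \<open>x \<in> K\<close> by blast
    then show ?thesis
      unfolding s_def using b I(2) by (intro sum_pos2[of I a]) auto
  qed
  obtain x0 where x0: "x0 \<in> K" "\<And>x. x \<in> K \<Longrightarrow> s x0 \<le> s x"
    using continuous_attains_inf[OF assms(1) False cont_s] by blast
  define c where "c = s x0"
  have c: "0 < c" "\<And>x. x \<in> K \<Longrightarrow> c \<le> s x" using x0 s_pos by (auto simp: c_def)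
  \<comment> \<open>As a function of \<open>s\<close> this is 0 up to \<open>c / 4\<close> and 1
    from \<open>c / 2\<close> on. The first threshold is positive, so \<open>h\<close> vanishes
    where \<open>s\<close> does; the second lies below the minimum \<open>c\<close> of
    \<open>s\<close> on \<open>K\<close>.\<close>
  define h where "h x = flat_exp 0 (s x - c / 4) *
    inverse (flat_exp 0 (s x - c / 4) + flat_exp 0 (c / 2 - s x))" for x
  \<comment> \<open>Both summands are nonnegative, and they vanish together only if
    \<open>c / 2 \<le> s x \<le> c / 4\<close>, impossible for \<open>c > 0\<close>.\<close>
  have denom: "flat_exp 0 (s x - c / 4) + flat_exp 0 (c / 2 - s x) \<noteq> 0" for x
    using c(1) by (auto simp: add_nonneg_eq_0_iff)
  have "smooth_on UNIV h"
    unfolding h_def[abs_def]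
    by (intro smooth_on_mult smooth_on_inverse smooth_on_add smooth_on_flat_exp smooth_on_diff
        smooth_s smooth_on_const open_UNIV denom)
  then have "test_function \<Omega> h"
  proof (rule test_functionI[where K = "\<Union>a\<in>I. cball a (r a)"])
    show "compact (\<Union>a\<in>I. cball a (r a))" using I by auto
    show "(\<Union>a\<in>I. cball a (r a)) \<subseteq> \<Omega>" using I r by blast
    show "h x = 0" if "x \<notin> (\<Union>a\<in>I. cball a (r a))" for x
    proof -
      have "b a x = 0" if "a \<in> I" for a
        using b(2,3)[of a x] that \<open>x \<notin> _\<close> by (auto simp: less_le)
      then have "s x = 0" by (simp add: s_def)
      then show ?thesis using c(1) by (simp add: h_def)
    qed
  qed
  moreover have "open {x. c / 2 < s x}"
    using cont_s by (intro open_Collect_less continuous_on_const)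
  moreover have "K \<subseteq> {x. c / 2 < s x}" using c by force
  moreover have "h x = 1" if "x \<in> {x. c / 2 < s x}" for x
  proof -
    have eq: "flat_exp 0 (c / 2 - s x) = 0" using that by simp
    have "h x = flat_exp 0 (s x - c / 4) * inverse (flat_exp 0 (s x - c / 4))"
      unfolding h_def eq by simp
    also have "\<dots> = 1"
      by (rule right_inverse) (use denom[of x, unfolded eq] in \<open>simp only: add_0_right not_False_eq_True\<close>)
    finally show ?thesis .
  qed
  ultimately show ?thesis using that by blast
qed

section \<open>Integration against test functions\<close>

lemma set_integrable_compact_support:
  fixes F :: "'a::euclidean_space \<Rightarrow> 'b::{banach, second_countable_topology}"
  assumes "continuous_on \<Omega> F" "compact K" "K \<subseteq> \<Omega>" "\<And>x. x \<in> \<Omega> - K \<Longrightarrow> F x = 0"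
  shows "set_integrable lborel \<Omega> F"
proof -
  have "(\<lambda>x. indicator \<Omega> x *\<^sub>R F x) = (\<lambda>x. indicator K x *\<^sub>R F x)"
    using assms(3,4) by (auto simp: fun_eq_iff indicator_def)
  then show ?thesis
    unfolding set_integrable_def
    using borel_integrable_compact[OF assms(2) continuous_on_subset[OF assms(1,3)]] by simp
qed

lemma set_integral_Re:
  assumes "set_integrable M A f"
  shows "(LINT x:A|M. Re (f x)) = Re (LINT x:A|M. f x)"
  using integral_Re[of M "\<lambda>x. indicator A x *\<^sub>R f x"] assms
  unfolding set_lebesgue_integral_def set_integrable_def by simp

text \<open>Squares suffice because the usual argument by contradiction uses a nonnegative bump
  inside the set where \<open>G\<close> has a fixed sign.\<close>

lemma fundamental_lemma_squares:
  fixes G :: "'a::euclidean_space \<Rightarrow> real"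
  assumes "open \<Omega>" "continuous_on \<Omega> G"
    and zero: "\<And>f. test_function \<Omega> f \<Longrightarrow> (LINT x:\<Omega>|lborel. f x * f x * G x) = 0"
    and "x \<in> \<Omega>"
  shows "G x = 0"
proof -
  \<comment> \<open>Stated for a general \<open>H\<close>, to be applied to both \<open>G\<close>
    and \<open>- G\<close>.\<close>
  have not_pos: "\<not> 0 < H y"
    if H: "continuous_on \<Omega> H" "\<And>f. test_function \<Omega> f \<Longrightarrow> (LINT x:\<Omega>|lborel. f x * f x * H x) = 0"
      and y: "y \<in> \<Omega>" for H :: "'a \<Rightarrow> real" and y
  proof
    assume pos: "0 < H y"
    define U where "U = {z \<in> \<Omega>. 0 < H z}"
    have "open U"
      using continuous_open_preimage[OF H(1) assms(1), of "{0<..}"]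
      by (simp add: U_def vimage_def Int_def)
    then obtain r where r: "0 < r" "cball y r \<subseteq> U"
      using pos y by (auto simp: U_def open_contains_cball)
    obtain f :: "'a \<Rightarrow> real" where f: "test_function U f" "\<And>x. 0 \<le> f x"
      "\<And>x. 0 < f x \<longleftrightarrow> x \<in> ball y r"
      using bump_function[OF r(2)] by blast
    obtain K where K: "compact K" "K \<subseteq> U" "\<And>x. x \<notin> K \<Longrightarrow> f x = 0"
      using test_function_compact_support[OF f(1)] by blast
    define F where "F x = indicator \<Omega> x * (f x * f x * H x)" for x
    have "continuous_on \<Omega> f"
      using f(1) by (intro smooth_on_imp_continuous_on test_function_imp_smooth_on)
    then have "set_integrable lborel \<Omega> (\<lambda>x. f x * f x * H x)"
      using H(1) K by (intro set_integrable_compact_support[where K = K] continuous_intros)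
        (auto simp: U_def)
    then have int: "integrable lborel F"
      by (simp add: F_def[abs_def] set_integrable_def)
    have nonneg: "0 \<le> F x" for x
      using K(2) K(3)[of x] by (cases "x \<in> K") (auto simp: F_def U_def intro: less_imp_le)
    have "test_function \<Omega> f"
      by (rule test_function_mono[OF f(1)]) (auto simp: U_def)
    then have "integral\<^sup>L lborel F = 0"
      using H(2) by (simp add: F_def[abs_def] set_lebesgue_integral_def)
    then have "AE x in lborel. F x = 0"
      using integral_nonneg_eq_0_iff_AE[OF int] nonneg by simp
    then have "AE x in lebesgue. F x = 0"
      by (rule AE_completion)
    moreover have "0 < F x" if "x \<in> ball y r" for x
    proof -
      have "x \<in> U" using that r(2) ball_subset_cball by blast
      then show ?thesis using that f(3)[of x] by (simp add: F_def U_def)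
    qed
    then have "F x = 0 \<Longrightarrow> x \<in> - ball y r" for x
      by (metis ComplI less_irrefl)
    ultimately have "AE x in lebesgue. x \<in> - ball y r"
      by (auto elim: eventually_mono)
    \<comment> \<open>A closed set containing almost every point is the whole space, yet this one
      misses \<open>y\<close>.\<close>
    then have "y \<in> - ball y r"
      by (intro mem_closed_if_AE_lebesgue) auto
    then show False using r(1) by simp
  qed
  have "\<not> 0 < G x" by (rule not_pos) (use assms in auto)
  moreover have "\<not> 0 < - G x"
    by (rule not_pos[where H = "\<lambda>x. - G x"]) (use assms in \<open>auto intro: continuous_intros simp: set_lebesgue_integral_def\<close>)
  ultimately show ?thesis by simp
qed

section \<open>Formally self-adjoint first order operators\<close>

lemma hdot_add_left: "hdot (a + b) c = hdot a c + hdot b c"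
  by (simp add: hdot_def algebra_simps sum.distrib)

lemma hdot_add_right: "hdot a (b + c) = hdot a b + hdot a c"
  by (simp add: hdot_def algebra_simps sum.distrib)

lemma hdot_diff_right: "hdot a (b - c) = hdot a b - hdot a c"
  by (simp add: hdot_def algebra_simps sum_subtractf)

lemma hdot_scaleR_left: "hdot (r *\<^sub>R a) b = r *\<^sub>R hdot a b"
  by (simp add: hdot_def scaleR_sum_right)

lemma hdot_scaleR_right: "hdot a (r *\<^sub>R b) = r *\<^sub>R hdot a b"
  by (simp add: hdot_def scaleR_sum_right)

lemma hdot_zero [simp]: "hdot 0 a = 0" "hdot a 0 = 0"
  by (simp_all add: hdot_def)

lemma cnj_hdot: "cnj (hdot a b) = hdot b a"
  by (simp add: hdot_def mult.commute)

lemma Re_hdot_commute: "Re (hdot a b) = Re (hdot b a)"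
  by (metis cnj_hdot complex_cnj(1) complex.sel(1) cnj.simps(1))

lemma hdot_self_eq_0: "Re (hdot a a) = 0 \<Longrightarrow> a = 0"
proof -
  assume "Re (hdot a a) = 0"
  then have "(\<Sum>i\<in>UNIV. (Re (a $ i))\<^sup>2 + (Im (a $ i))\<^sup>2) = 0"
    by (simp add: hdot_def power2_eq_square)
  then show "a = 0"
    by (simp add: sum_nonneg_eq_0_iff sum_power2_eq_zero_iff vec_eq_iff complex_eq_iff)
qed

lemma continuous_on_hdot [continuous_intros]:
  "continuous_on S f \<Longrightarrow> continuous_on S g \<Longrightarrow> continuous_on S (\<lambda>x. hdot (f x) (g x))"
  unfolding hdot_def by (intro continuous_intros)

lemma continuous_on_matrix_vector_mult:
  fixes M :: "'a::topological_space \<Rightarrow> complex ^ 'm ^ 'k"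
  assumes "continuous_on S M" "continuous_on S f"
  shows "continuous_on S (\<lambda>x. M x *v f x)"
  unfolding matrix_vector_mult_def using assms by (intro continuous_intros continuous_on_vec_lambda) auto

lemma matrix_vector_mult_scaleR_complex:
  fixes M :: "complex ^ 'm ^ 'k"
  shows "M *v (r *\<^sub>R a) = r *\<^sub>R (M *v a)"
  by (simp add: matrix_vector_mult_def vec_eq_iff scaleR_sum_right)

lemma partial_deriv_eqI: "(f has_derivative f') (at x) \<Longrightarrow> partial_deriv j f x = f' (axis j 1)"
  unfolding partial_deriv_def using frechet_derivative_at by metis

lemma partial_deriv_add_scaleR:
  assumes "smooth_on \<Omega> u" "smooth_on \<Omega> v" "x \<in> \<Omega>"
  shows "partial_deriv j (\<lambda>y. u y + t *\<^sub>R v y) x = partial_deriv j u x + t *\<^sub>R partial_deriv j v x"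
proof -
  have "((\<lambda>y. u y + t *\<^sub>R v y) has_derivative
      (\<lambda>w. frechet_derivative u (at x) w + t *\<^sub>R frechet_derivative v (at x) w)) (at x)"
    using assms by (intro has_derivative_add has_derivative_scaleR_right smooth_on_has_derivative)
  from partial_deriv_eqI[OF this] show ?thesis by (simp add: partial_deriv_def)
qed

lemma partial_deriv_scaleR:
  assumes "smooth_on \<Omega> h" "smooth_on \<Omega> u" "x \<in> \<Omega>"
  shows "partial_deriv j (\<lambda>y. h y *\<^sub>R u y) x = h x *\<^sub>R partial_deriv j u x + partial_deriv j h x *\<^sub>R u x"
proof -
  have "((\<lambda>y. h y *\<^sub>R u y) has_derivative (\<lambda>w. h x *\<^sub>R frechet_derivative u (at x) w +
      frechet_derivative h (at x) w *\<^sub>R u x)) (at x)"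
    using assms by (intro has_derivative_scaleR smooth_on_has_derivative)
  from partial_deriv_eqI[OF this] show ?thesis by (simp add: partial_deriv_def)
qed

lemma partial_deriv_cong:
  assumes "smooth_on \<Omega> u" "x \<in> \<Omega>" "open N" "x \<in> N" "\<And>y. y \<in> N \<Longrightarrow> u y = v y"
  shows "partial_deriv j v x = partial_deriv j u x"
proof -
  have "(v has_derivative frechet_derivative u (at x)) (at x)"
    using smooth_on_has_derivative[OF assms(1,2)] assms(3-5)
    by (rule has_derivative_transform_within_open)
  from partial_deriv_eqI[OF this] show ?thesis by (simp add: partial_deriv_def)
qed

text \<open>For a first order \<open>A\<close> with leading coefficients \<open>B j\<close> this is
  \<open>u\<close> multiplied by the matrix \<open>\<Sum>j. (\<partial>j h) B j\<close>: exactly the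
  terms in which \<open>h\<close> is differentiated.\<close>

definition commutator ::
  "((real ^ 'n \<Rightarrow> complex ^ 'm) \<Rightarrow> (real ^ 'n \<Rightarrow> complex ^ 'm)) \<Rightarrow>
   (real ^ 'n \<Rightarrow> real) \<Rightarrow> (real ^ 'n \<Rightarrow> complex ^ 'm) \<Rightarrow> real ^ 'n \<Rightarrow> complex ^ 'm" where
  "commutator A h u x = A (\<lambda>y. h y *\<^sub>R u y) x - h x *\<^sub>R A u x"

text \<open>The coefficient of \<open>t\<close> in \<open>op_Lagrangian A\<close> at
  \<open>u + t \<phi>\<close>, that is, its differential at \<open>u\<close> in direction
  \<open>\<phi>\<close>.\<close>

definition op_variation ::
  "((real ^ 'n \<Rightarrow> complex ^ 'm) \<Rightarrow> (real ^ 'n \<Rightarrow> complex ^ 'm)) \<Rightarrow>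
   (real ^ 'n \<Rightarrow> complex ^ 'm) \<Rightarrow> (real ^ 'n \<Rightarrow> complex ^ 'm) \<Rightarrow> real ^ 'n \<Rightarrow> real" where
  "op_variation A u \<phi> x = Re (hdot (\<phi> x) (A u x)) + Re (hdot (u x) (A \<phi> x))"

locale symmetric_op =
  fixes \<Omega> :: "(real ^ 'n) set"
    and A :: "(real ^ 'n \<Rightarrow> complex ^ 'm) \<Rightarrow> (real ^ 'n \<Rightarrow> complex ^ 'm)"
  assumes open_domain: "open \<Omega>"
    and diff_op: "first_order_diff_op \<Omega> A"
    and symmetric: "formally_self_adjoint \<Omega> A"
begin

lemma continuous_on_op: "smooth_on \<Omega> u \<Longrightarrow> continuous_on \<Omega> (A u)"
proof -
  assume u: "smooth_on \<Omega> u"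
  obtain B C where BC: "\<And>j. smooth_on \<Omega> (B j)" "smooth_on \<Omega> C"
    "\<And>u x. smooth_on \<Omega> u \<Longrightarrow> x \<in> \<Omega> \<Longrightarrow>
      A u x = (\<Sum>j\<in>UNIV. B j x *v partial_deriv j u x) + C x *v u x"
    using diff_op unfolding first_order_diff_op_def by blast
  have "continuous_on \<Omega> (\<lambda>x. (\<Sum>j\<in>UNIV. B j x *v partial_deriv j u x) + C x *v u x)"
    using BC u by (intro continuous_intros continuous_on_matrix_vector_mult
        smooth_on_continuous_partial_deriv smooth_on_imp_continuous_on)
  then show ?thesis
    using BC(3)[OF u] by (simp cong: continuous_on_cong)
qed

text \<open>Locality. Both functions must be smooth, since \<open>first_order_diff_op\<close>
  constrains \<open>A\<close> on smooth functions only.\<close>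

lemma op_cong:
  assumes "smooth_on \<Omega> u" "smooth_on \<Omega> v" "x \<in> \<Omega>" "open N" "x \<in> N" "\<And>y. y \<in> N \<Longrightarrow> u y = v y"
  shows "A u x = A v x"
proof -
  have "partial_deriv j u x = partial_deriv j v x" for j
    using partial_deriv_cong[OF assms(1,3,4,5,6)] by simp
  moreover have "u x = v x" using assms by simp
  moreover obtain B C where BC: "\<And>j. smooth_on \<Omega> (B j)" "smooth_on \<Omega> C"
    "\<And>u x. smooth_on \<Omega> u \<Longrightarrow> x \<in> \<Omega> \<Longrightarrow>
      A u x = (\<Sum>j\<in>UNIV. B j x *v partial_deriv j u x) + C x *v u x"
    using diff_op unfolding first_order_diff_op_def by blast
  ultimately show ?thesis using assms by simp
qed

lemma op_add_scaleR:
  assumes "smooth_on \<Omega> u" "smooth_on \<Omega> v" "x \<in> \<Omega>"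
  shows "A (\<lambda>y. u y + t *\<^sub>R v y) x = A u x + t *\<^sub>R A v x"
proof -
  obtain B C where BC: "\<And>j. smooth_on \<Omega> (B j)" "smooth_on \<Omega> C"
    "\<And>u x. smooth_on \<Omega> u \<Longrightarrow> x \<in> \<Omega> \<Longrightarrow>
      A u x = (\<Sum>j\<in>UNIV. B j x *v partial_deriv j u x) + C x *v u x"
    using diff_op unfolding first_order_diff_op_def by blast
  have "smooth_on \<Omega> (\<lambda>y. u y + t *\<^sub>R v y)"
    using assms open_domain by (intro smooth_on_add smooth_on_scaleR smooth_on_const)
  then show ?thesis
    using assms by (simp add: BC(3) partial_deriv_add_scaleR[OF assms] matrix_vector_right_distrib
        matrix_vector_mult_scaleR_complex sum.distrib scaleR_sum_right scaleR_right_distrib)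
qed

lemma op_eq_0:
  assumes "smooth_on \<Omega> u" "x \<in> \<Omega>" "open N" "x \<in> N" "\<And>y. y \<in> N \<Longrightarrow> u y = 0"
  shows "A u x = 0"
proof -
  \<comment> \<open>Near \<open>x\<close> both \<open>u\<close> and \<open>u + u\<close> vanish, so
    locality and additivity give \<open>A u x = A u x + A u x\<close>.\<close>
  have "smooth_on \<Omega> (\<lambda>y. u y + 1 *\<^sub>R u y)"
    by (intro smooth_on_add smooth_on_scaleR smooth_on_const assms open_domain)
  then have "A u x = A (\<lambda>y. u y + 1 *\<^sub>R u y) x"
    by (rule op_cong[OF assms(1) _ assms(2-4)]) (simp add: assms(5))
  also have "\<dots> = A u x + A u x"
    using op_add_scaleR[OF assms(1,1,2), of 1] by simp
  finally show ?thesis by simp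
qed

text \<open>The commutator has order zero, so \<open>f\<close> passes through it without being
  differentiated.\<close>

lemma commutator_scaleR:
  assumes "smooth_on \<Omega> h" "smooth_on \<Omega> f" "smooth_on \<Omega> u" "x \<in> \<Omega>"
  shows "commutator A h (\<lambda>y. f y *\<^sub>R u y) x = f x *\<^sub>R commutator A h u x"
proof -
  obtain B C where BC: "\<And>j. smooth_on \<Omega> (B j)" "smooth_on \<Omega> C"
    "\<And>u x. smooth_on \<Omega> u \<Longrightarrow> x \<in> \<Omega> \<Longrightarrow>
      A u x = (\<Sum>j\<in>UNIV. B j x *v partial_deriv j u x) + C x *v u x"
    using diff_op unfolding first_order_diff_op_def by blast
  have comm: "commutator A h v x = (\<Sum>j\<in>UNIV. partial_deriv j h x *\<^sub>R (B j x *v v x))"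
    if v: "smooth_on \<Omega> v" for v
  proof -
    have "smooth_on \<Omega> (\<lambda>y. h y *\<^sub>R v y)"
      using assms v open_domain by (intro smooth_on_scaleR)
    then show ?thesis
      using assms v by (simp add: commutator_def BC(3) partial_deriv_scaleR[OF assms(1) v assms(4)]
          matrix_vector_right_distrib matrix_vector_mult_scaleR_complex sum.distrib
          scaleR_sum_right scaleR_right_distrib)
  qed
  have "smooth_on \<Omega> (\<lambda>y. f y *\<^sub>R u y)"
    using assms open_domain by (intro smooth_on_scaleR)
  then show ?thesis
    using assms(3)
    by (simp add: comm matrix_vector_mult_scaleR_complex scaleR_sum_right mult.commute)
qed

lemma continuous_on_commutator:
  assumes "smooth_on \<Omega> h" "smooth_on \<Omega> u"
  shows "continuous_on \<Omega> (commutator A h u)"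
  unfolding commutator_def[abs_def] using assms open_domain
  by (intro continuous_intros continuous_on_op smooth_on_scaleR smooth_on_imp_continuous_on)

text \<open>By locality \<open>A\<close> does not enlarge supports. The last claim stays inside
  \<open>\<Omega>\<close> because \<open>A \<phi>\<close> is unconstrained elsewhere.\<close>

lemma test_function_op_support:
  assumes "test_function \<Omega> \<phi>"
  obtains K where "compact K" "K \<subseteq> \<Omega>" "\<And>x. x \<notin> K \<Longrightarrow> \<phi> x = 0" "\<And>x. x \<in> \<Omega> - K \<Longrightarrow> A \<phi> x = 0"
proof -
  obtain K where K: "compact K" "K \<subseteq> \<Omega>" "\<And>x. x \<notin> K \<Longrightarrow> \<phi> x = 0"
    using test_function_compact_support[OF assms] by blast
  have "A \<phi> x = 0" if "x \<in> \<Omega> - K" for x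
    by (rule op_eq_0[where N = "- K"])
      (use K that assms in \<open>auto intro: test_function_imp_smooth_on compact_imp_closed\<close>)
  with K that show ?thesis by blast
qed

text \<open>Extends symmetry to a \<open>u\<close> without compact support. With
  \<open>h = 1\<close> near the support \<open>K\<close> of \<open>\<phi>\<close>, the test function
  \<open>h u\<close> agrees with \<open>u\<close> near \<open>K\<close>; hence so do their images
  under \<open>A\<close> on \<open>K\<close>, and the integrands vanish elsewhere in
  \<open>\<Omega>\<close>.\<close>

lemma symmetric_weak:
  assumes "test_function \<Omega> \<phi>" "smooth_on \<Omega> u"
  shows "set_integrable lborel \<Omega> (\<lambda>x. hdot (u x) (A \<phi> x))"
    and "set_integrable lborel \<Omega> (\<lambda>x. hdot (A u x) (\<phi> x))"
    and "(LINT x:\<Omega>|lborel. hdot (u x) (A \<phi> x)) = (LINT x:\<Omega>|lborel. hdot (A u x) (\<phi> x))"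
proof -
  note \<phi> = test_function_imp_smooth_on[OF assms(1)]
  obtain K where K: "compact K" "K \<subseteq> \<Omega>" "\<And>x. x \<notin> K \<Longrightarrow> \<phi> x = 0"
    "\<And>x. x \<in> \<Omega> - K \<Longrightarrow> A \<phi> x = 0"
    using test_function_op_support[OF assms(1)] by blast
  show "set_integrable lborel \<Omega> (\<lambda>x. hdot (u x) (A \<phi> x))"
    using K assms \<phi> by (intro set_integrable_compact_support[where K = K] continuous_intros
        continuous_on_op smooth_on_imp_continuous_on) auto
  show "set_integrable lborel \<Omega> (\<lambda>x. hdot (A u x) (\<phi> x))"
    using K assms \<phi> by (intro set_integrable_compact_support[where K = K] continuous_intros
        continuous_on_op smooth_on_imp_continuous_on) auto
  obtain h :: "real ^ 'n \<Rightarrow> real" and N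
    where h: "test_function \<Omega> h" "open N" "K \<subseteq> N" "\<And>x. x \<in> N \<Longrightarrow> h x = 1"
    using cutoff_function[OF K(1) open_domain K(2)] by blast
  define v where "v x = h x *\<^sub>R u x" for x
  have v: "test_function \<Omega> v"
    unfolding v_def[abs_def] using test_function_scaleR[OF open_domain h(1) assms(2)] .
  have meas: "\<Omega> \<in> sets lborel" using open_domain by simp
  have "(LINT x:\<Omega>|lborel. hdot (u x) (A \<phi> x)) = (LINT x:\<Omega>|lborel. hdot (v x) (A \<phi> x))"
  proof (rule set_lebesgue_integral_cong[OF meas], intro allI impI)
    fix x assume "x \<in> \<Omega>"
    then show "hdot (u x) (A \<phi> x) = hdot (v x) (A \<phi> x)"
      using K h by (cases "x \<in> K") (auto simp: v_def)
  qed
  also have "\<dots> = (LINT x:\<Omega>|lborel. hdot (A v x) (\<phi> x))"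
    using symmetric v assms(1) unfolding formally_self_adjoint_def L2_product_def by blast
  also have "\<dots> = (LINT x:\<Omega>|lborel. hdot (A u x) (\<phi> x))"
  proof (rule set_lebesgue_integral_cong[OF meas], intro allI impI)
    fix x assume x: "x \<in> \<Omega>"
    show "hdot (A v x) (\<phi> x) = hdot (A u x) (\<phi> x)"
    proof (cases "x \<in> K")
      case True
      have "A v x = A u x"
        by (rule op_cong[where N = N])
          (use True x h assms(2) in \<open>auto simp: v_def test_function_imp_smooth_on[OF v]\<close>)
      then show ?thesis by simp
    qed (use K in auto)
  qed
  finally show "(LINT x:\<Omega>|lborel. hdot (u x) (A \<phi> x)) = (LINT x:\<Omega>|lborel. hdot (A u x) (\<phi> x))" .
qed


text \<open>Symmetry gives the two halves of \<open>op_variation\<close> equal integrals, so its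
  total is twice the weak form of \<open>A u = 0\<close>.\<close>

lemma integral_op_variation:
  assumes "test_function \<Omega> \<phi>" "smooth_on \<Omega> u"
  shows "(LINT x:\<Omega>|lborel. Re (hdot (u x) (A \<phi> x))) = (LINT x:\<Omega>|lborel. Re (hdot (\<phi> x) (A u x)))"
    (is ?eq)
    and "set_integrable lborel \<Omega> (op_variation A u \<phi>)"
    and "(LINT x:\<Omega>|lborel. op_variation A u \<phi> x) = 2 * (LINT x:\<Omega>|lborel. Re (hdot (\<phi> x) (A u x)))"
proof -
  have Re: "Re (hdot (\<phi> x) (A u x)) = Re (hdot (A u x) (\<phi> x))" for x
    by (rule Re_hdot_commute)
  show eq: ?eq
    unfolding Re using symmetric_weak[OF assms] by (simp add: set_integral_Re)
  have int: "set_integrable lborel \<Omega> (\<lambda>x. Re (hdot (\<phi> x) (A u x)))"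
    "set_integrable lborel \<Omega> (\<lambda>x. Re (hdot (u x) (A \<phi> x)))"
    unfolding Re using symmetric_weak(1,2)[OF assms]
    by (auto simp: set_integrable_def dest: integrable_Re)
  show "set_integrable lborel \<Omega> (op_variation A u \<phi>)"
    unfolding op_variation_def[abs_def] by (rule set_integral_add(1)[OF int])
  show "(LINT x:\<Omega>|lborel. op_variation A u \<phi> x) = 2 * (LINT x:\<Omega>|lborel. Re (hdot (\<phi> x) (A u x)))"
    unfolding op_variation_def using set_integral_add(2)[OF int] eq by simp
qed

text \<open>Symmetry applied to \<open>h w\<close> and \<open>w\<close> with \<open>w = f u\<close> gives \<open>\<integral> f\<^sup>2 Re (u\<^sup>* [A, h] u) = 0\<close> for every real
  \<open>f\<close>, because \<open>[A, h]\<close> has order zero.\<close>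

lemma Re_hdot_commutator:
  assumes "test_function \<Omega> h" "smooth_on \<Omega> u" "x \<in> \<Omega>"
  shows "Re (hdot (u x) (commutator A h u x)) = 0"
proof (rule fundamental_lemma_squares[OF open_domain _ _ assms(3)])
  note h = test_function_imp_smooth_on[OF assms(1)]
  show "continuous_on \<Omega> (\<lambda>x. Re (hdot (u x) (commutator A h u x)))"
    using assms(2) h by (intro continuous_intros continuous_on_commutator smooth_on_imp_continuous_on)
  fix f :: "real ^ 'n \<Rightarrow> real" assume "test_function \<Omega> f"
  note f = test_function_imp_smooth_on[OF this]
  define w where "w x = f x *\<^sub>R u x" for x
  have w: "smooth_on \<Omega> w"
    unfolding w_def[abs_def] using open_domain f assms(2) by (intro smooth_on_scaleR)
  define \<phi> where "\<phi> x = h x *\<^sub>R w x" for x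
  have \<phi>: "test_function \<Omega> \<phi>"
    unfolding \<phi>_def[abs_def] using test_function_scaleR[OF open_domain assms(1) w] .
  have meas: "\<Omega> \<in> sets lborel" using open_domain by simp
  have int: "set_integrable lborel \<Omega> (\<lambda>x. Re (hdot (w x) (A \<phi> x)))"
    "set_integrable lborel \<Omega> (\<lambda>x. Re (hdot (\<phi> x) (A w x)))"
    using symmetric_weak(1,2)[OF \<phi> w]
    by (auto simp: set_integrable_def Re_hdot_commute[of "\<phi> _"] dest: integrable_Re)
  have "(LINT x:\<Omega>|lborel. f x * f x * Re (hdot (u x) (commutator A h u x))) =
      (LINT x:\<Omega>|lborel. Re (hdot (w x) (A \<phi> x)) - Re (hdot (\<phi> x) (A w x)))"
  proof (rule set_lebesgue_integral_cong[OF meas], intro allI impI)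
    fix x assume x: "x \<in> \<Omega>"
    have "f x * f x * Re (hdot (u x) (commutator A h u x)) = Re (hdot (w x) (commutator A h w x))"
      using commutator_scaleR[OF h f assms(2) x]
      by (simp add: w_def[abs_def] hdot_scaleR_left hdot_scaleR_right)
    then show "f x * f x * Re (hdot (u x) (commutator A h u x)) =
        Re (hdot (w x) (A \<phi> x)) - Re (hdot (\<phi> x) (A w x))"
      by (simp add: commutator_def \<phi>_def[abs_def] hdot_diff_right hdot_scaleR_left hdot_scaleR_right)
  qed
  also have "\<dots> = 0"
    using set_integral_diff(2)[OF int] integral_op_variation(1)[OF \<phi> w] by simp
  finally show "(LINT x:\<Omega>|lborel. f x * f x * Re (hdot (u x) (commutator A h u x))) = 0" .
qed

text \<open>In \<open>A (h u) = h A u + [A, h] u\<close> the commutator pairs with \<open>u\<close>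
  to zero real part, so \<open>h\<close> acts as if it were constant.\<close>

lemma op_variation_scaleR:
  assumes "test_function \<Omega> h" "smooth_on \<Omega> u" "x \<in> \<Omega>"
  shows "op_variation A u (\<lambda>y. h y *\<^sub>R u y) x = 2 * h x * op_Lagrangian A u x"
  using Re_hdot_commutator[OF assms]
  by (simp add: op_variation_def op_Lagrangian_def commutator_def hdot_diff_right
      hdot_scaleR_left hdot_scaleR_right)

lemma continuous_on_op_Lagrangian:
  "smooth_on \<Omega> u \<Longrightarrow> continuous_on \<Omega> (op_Lagrangian A u)"
  unfolding op_Lagrangian_def[abs_def]
  by (intro continuous_intros continuous_on_op smooth_on_imp_continuous_on)

lemma op_Lagrangian_add_scaleR:
  assumes "smooth_on \<Omega> u" "smooth_on \<Omega> \<phi>" "x \<in> \<Omega>"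
  shows "op_Lagrangian A (\<lambda>y. u y + t *\<^sub>R \<phi> y) x =
    op_Lagrangian A u x + t * op_variation A u \<phi> x + t\<^sup>2 * op_Lagrangian A \<phi> x"
  by (simp add: op_Lagrangian_def op_variation_def op_add_scaleR[OF assms] hdot_add_left hdot_add_right
      hdot_scaleR_left hdot_scaleR_right algebra_simps power2_eq_square)

text \<open>Testing with \<open>f\<^sup>2 c\<close> for a constant vector \<open>c\<close> reduces
  the vector equation to the scalar fundamental lemma on \<open>S\<close>.\<close>

lemma weak_solution_imp_solution:
  assumes "smooth_on \<Omega> u" "open S" "S \<subseteq> \<Omega>" "x \<in> S"
    and weak: "\<And>\<phi>. test_function S \<phi> \<Longrightarrow> (LINT x:\<Omega>|lborel. Re (hdot (\<phi> x) (A u x))) = 0"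
  shows "A u x = 0"
proof -
  \<comment> \<open>Freezing \<open>c\<close> at the value in question makes the conclusion at
    \<open>x\<close> say that \<open>c\<close> has norm zero.\<close>
  define c where "c = A u x"
  have "Re (hdot c (A u x)) = 0"
  proof (rule fundamental_lemma_squares[OF assms(2) _ _ assms(4)])
    show "continuous_on S (\<lambda>x. Re (hdot c (A u x)))"
      by (rule continuous_on_subset[OF _ assms(3)])
        (intro continuous_intros continuous_on_op assms)
    fix f :: "real ^ 'n \<Rightarrow> real" assume f: "test_function S f"
    define \<phi> where "\<phi> x = f x *\<^sub>R (f x *\<^sub>R c)" for x
    have "test_function S \<phi>"
      unfolding \<phi>_def[abs_def] using assms(2) f
      by (intro test_function_scaleR smooth_on_scaleR test_function_imp_smooth_on[OF f] smooth_on_const)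
    then have "(LINT x:\<Omega>|lborel. Re (hdot (\<phi> x) (A u x))) = 0" by (rule weak)
    moreover obtain K where K: "compact K" "K \<subseteq> S" "\<And>x. x \<notin> K \<Longrightarrow> f x = 0"
      using test_function_compact_support[OF f] by blast
    have "indicator S x * (f x * f x * Re (hdot c (A u x))) =
        indicator \<Omega> x * Re (hdot (\<phi> x) (A u x))" for x
      using K assms(3) by (cases "x \<in> S") (auto simp: \<phi>_def hdot_scaleR_left indicator_def)
    then have "(LINT x:S|lborel. f x * f x * Re (hdot c (A u x))) =
        (LINT x:\<Omega>|lborel. Re (hdot (\<phi> x) (A u x)))"
      by (simp add: set_lebesgue_integral_def)
    ultimately show "(LINT x:S|lborel. f x * f x * Re (hdot c (A u x))) = 0" by simp
  qed
  then show ?thesis unfolding c_def by (rule hdot_self_eq_0)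
qed

end

section \<open>The quotient Lagrangian\<close>

text \<open>Euler's identity for \<open>a b / (a - b)\<close>: the right side is its differential
  for the increments \<open>2 c a\<close> and \<open>2 c b\<close>.\<close>

lemma quotient_identity:
  fixes a b c :: real
  assumes "a \<noteq> b"
  shows "c * (2 * (a * b / (a - b))) = (a\<^sup>2 * (2 * c * b) - b\<^sup>2 * (2 * c * a)) / (a - b)\<^sup>2"
proof -
  have "a\<^sup>2 * (2 * c * b) - b\<^sup>2 * (2 * c * a) = 2 * c * a * b * (a - b)"
    by (simp add: power2_eq_square algebra_simps)
  then show ?thesis
    using assms by (simp add: power2_eq_square)
qed

locale symmetric_op_pair =
  plus: symmetric_op \<Omega> Ap + minus: symmetric_op \<Omega> Am
  for \<Omega> :: "(real ^ 'n) set"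
    and Ap Am :: "(real ^ 'n \<Rightarrow> complex ^ 'm) \<Rightarrow> (real ^ 'n \<Rightarrow> complex ^ 'm)" +
  fixes u :: "real ^ 'n \<Rightarrow> complex ^ 'm"
  assumes smooth_u: "smooth_on \<Omega> u"
    and Lagrangians_neq: "\<And>x. x \<in> \<Omega> \<Longrightarrow> op_Lagrangian Ap u x \<noteq> op_Lagrangian Am u x"
begin

text \<open>Along \<open>u + t \<phi>\<close> both Lagrangians are quadratic polynomials in
  \<open>t\<close>, with different values at \<open>t = 0\<close>. The weights are the partial
  derivatives of \<open>a b / (a - b)\<close>, namely \<open>- b\<^sup>2 / (a - b)\<^sup>2\<close>
  and \<open>a\<^sup>2 / (a - b)\<^sup>2\<close>.\<close>

lemma quotient_Lagrangian_derivative: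
  assumes "test_function \<Omega> \<phi>" "x \<in> \<Omega>"
  shows "((\<lambda>t. quotient_Lagrangian Ap Am (\<lambda>y. u y + t *\<^sub>R \<phi> y) x) has_real_derivative
    ((op_Lagrangian Ap u x)\<^sup>2 * op_variation Am u \<phi> x
      - (op_Lagrangian Am u x)\<^sup>2 * op_variation Ap u \<phi> x)
     / (op_Lagrangian Ap u x - op_Lagrangian Am u x)\<^sup>2) (at 0)"
proof -
  note \<phi> = test_function_imp_smooth_on[OF assms(1), of \<Omega>]
  show ?thesis
    unfolding quotient_Lagrangian_def plus.op_Lagrangian_add_scaleR[OF smooth_u \<phi> assms(2)]
      minus.op_Lagrangian_add_scaleR[OF smooth_u \<phi> assms(2)]
    using Lagrangians_neq[OF assms(2)]
    by (auto intro!: derivative_eq_intros simp: power2_eq_square algebra_simps)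
qed

lemma variation_density_eq:
  assumes "test_function \<Omega> \<phi>" "x \<in> \<Omega>"
  shows "variation_density (quotient_Lagrangian Ap Am) u \<phi> x =
    ((op_Lagrangian Ap u x)\<^sup>2 * op_variation Am u \<phi> x
      - (op_Lagrangian Am u x)\<^sup>2 * op_variation Ap u \<phi> x)
     / (op_Lagrangian Ap u x - op_Lagrangian Am u x)\<^sup>2"
  unfolding variation_density_def by (rule DERIV_imp_deriv[OF quotient_Lagrangian_derivative[OF assms]])

lemma Euler_Lagrange_imp_product_eq_0:
  assumes "Euler_Lagrange_solution \<Omega> (quotient_Lagrangian Ap Am) u" "x \<in> \<Omega>"
  shows "op_Lagrangian Ap u x * op_Lagrangian Am u x = 0"
proof -
  have "2 * quotient_Lagrangian Ap Am u x = 0"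
  proof (rule fundamental_lemma_squares[OF plus.open_domain _ _ assms(2)])
    show "continuous_on \<Omega> (\<lambda>x. 2 * quotient_Lagrangian Ap Am u x)"
      unfolding quotient_Lagrangian_def using Lagrangians_neq
      by (intro continuous_intros plus.continuous_on_op_Lagrangian
          minus.continuous_on_op_Lagrangian smooth_u) auto
    fix f :: "real ^ 'n \<Rightarrow> real" assume f: "test_function \<Omega> f"
    \<comment> \<open>The multiplier is a square to fit
      \<open>fundamental_lemma_squares\<close>.\<close>
    define h where "h x = f x * f x" for x
    have h: "test_function \<Omega> h"
      unfolding h_def[abs_def] using test_function_scaleR[OF plus.open_domain f
          test_function_imp_smooth_on[OF f]] by simp
    have \<phi>: "test_function \<Omega> (\<lambda>x. h x *\<^sub>R u x)"
      by (rule test_function_scaleR[OF plus.open_domain h smooth_u])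
    have "(LINT x:\<Omega>|lborel. f x * f x * (2 * quotient_Lagrangian Ap Am u x)) =
      (LINT x:\<Omega>|lborel. variation_density (quotient_Lagrangian Ap Am) u (\<lambda>x. h x *\<^sub>R u x) x)"
    proof (rule set_lebesgue_integral_cong, simp add: plus.open_domain, intro allI impI)
      fix x assume x: "x \<in> \<Omega>"
      show "f x * f x * (2 * quotient_Lagrangian Ap Am u x) =
          variation_density (quotient_Lagrangian Ap Am) u (\<lambda>x. h x *\<^sub>R u x) x"
        unfolding variation_density_eq[OF \<phi> x] plus.op_variation_scaleR[OF h smooth_u x]
          minus.op_variation_scaleR[OF h smooth_u x]
        unfolding quotient_Lagrangian_def h_def
        by (rule quotient_identity[OF Lagrangians_neq[OF x]])
    qed
    also have "\<dots> = 0"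
      using assms(1) \<phi> unfolding Euler_Lagrange_solution_def by blast
    finally show "(LINT x:\<Omega>|lborel. f x * f x * (2 * quotient_Lagrangian Ap Am u x)) = 0" .
  qed
  then show ?thesis
    using Lagrangians_neq[OF assms(2)] by (simp add: quotient_Lagrangian_def)
qed

section \<open>Splitting \<open>\<Omega>\<close> by the zero sets of the two Lagrangians\<close>

definition plus_zero :: "(real ^ 'n) set" where
  "plus_zero = {x \<in> \<Omega>. op_Lagrangian Ap u x = 0}"

definition minus_zero :: "(real ^ 'n) set" where
  "minus_zero = {x \<in> \<Omega>. op_Lagrangian Am u x = 0}"

context
  assumes product_eq_0: "\<And>x. x \<in> \<Omega> \<Longrightarrow> op_Lagrangian Ap u x * op_Lagrangian Am u x = 0"
begin

lemma zero_sets: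
  shows "plus_zero \<union> minus_zero = \<Omega>" "plus_zero \<inter> minus_zero = {}"
  using product_eq_0 Lagrangians_neq by (fastforce simp: plus_zero_def minus_zero_def)+

text \<open>A zero set is a priori only relatively closed; but one Lagrangian vanishes exactly where
  the other does not, which is an open condition.\<close>

lemma open_zero_sets: "open plus_zero" "open minus_zero"
proof -
  have "plus_zero = \<Omega> \<inter> op_Lagrangian Am u -` (- {0})"
    using product_eq_0 Lagrangians_neq by (fastforce simp: plus_zero_def)
  then show "open plus_zero"
    using continuous_open_preimage[OF minus.continuous_on_op_Lagrangian[OF smooth_u] plus.open_domain]
    by (metis open_delete open_UNIV Compl_eq_Diff_UNIV)
  have "minus_zero = \<Omega> \<inter> op_Lagrangian Ap u -` (- {0})"
    using product_eq_0 Lagrangians_neq by (fastforce simp: minus_zero_def)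
  then show "open minus_zero"
    using continuous_open_preimage[OF plus.continuous_on_op_Lagrangian[OF smooth_u] plus.open_domain]
    by (metis open_delete open_UNIV Compl_eq_Diff_UNIV)
qed

text \<open>Where one Lagrangian vanishes, the weight of the other one's variation is 0 and its own
  is \<open>-1\<close> on \<open>plus_zero\<close> and \<open>1\<close> on
  \<open>minus_zero\<close>. The two parts of \<open>\<phi>\<close> are test functions on all of
  \<open>\<Omega>\<close>, so symmetry applies to each operator separately.\<close>

lemma first_variation:
  fixes \<phi> :: "real ^ 'n \<Rightarrow> complex ^ 'm"
  assumes "test_function \<Omega> \<phi>"
  defines "\<phi>p \<equiv> \<lambda>x. if x \<in> plus_zero then \<phi> x else 0"
    and "\<phi>m \<equiv> \<lambda>x. if x \<in> minus_zero then \<phi> x else 0"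
  shows "set_integrable lborel \<Omega> (variation_density (quotient_Lagrangian Ap Am) u \<phi>)"
    and "(LINT x:\<Omega>|lborel. variation_density (quotient_Lagrangian Ap Am) u \<phi> x) =
      2 * (LINT x:\<Omega>|lborel. Re (hdot (\<phi>m x) (Am u x)))
      - 2 * (LINT x:\<Omega>|lborel. Re (hdot (\<phi>p x) (Ap u x)))"
proof -
  have "test_function plus_zero \<phi>p"
    unfolding \<phi>p_def
    by (rule test_function_restrict[of _ minus_zero]) (use assms(1) zero_sets open_zero_sets in auto)
  then have p: "test_function \<Omega> \<phi>p"
    by (rule test_function_mono) (use zero_sets in auto)
  have "test_function minus_zero \<phi>m"
    unfolding \<phi>m_def
    by (rule test_function_restrict[of _ plus_zero])
      (use assms(1) zero_sets open_zero_sets in \<open>auto simp: Un_commute\<close>)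
  then have m: "test_function \<Omega> \<phi>m"
    by (rule test_function_mono) (use zero_sets in auto)
  note smooth = test_function_imp_smooth_on[OF assms(1)] test_function_imp_smooth_on[OF p]
    test_function_imp_smooth_on[OF m]
  have eq: "variation_density (quotient_Lagrangian Ap Am) u \<phi> x =
      op_variation Am u \<phi>m x - op_variation Ap u \<phi>p x" if x: "x \<in> \<Omega>" for x
  proof (cases "x \<in> plus_zero")
    case True
    have "Ap \<phi>p x = Ap \<phi> x"
      by (rule plus.op_cong[OF smooth(2,1) x open_zero_sets(1) True]) (simp add: \<phi>p_def)
    moreover have "Am \<phi>m x = 0"
      by (rule minus.op_eq_0[OF smooth(3) x open_zero_sets(1) True])
        (use zero_sets in \<open>auto simp: \<phi>m_def\<close>)
    moreover have "\<phi>p x = \<phi> x" "\<phi>m x = 0"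
      using True zero_sets by (auto simp: \<phi>p_def \<phi>m_def)
    moreover have "op_Lagrangian Ap u x = 0" using True by (simp add: plus_zero_def)
    ultimately show ?thesis
      using Lagrangians_neq[OF x]
      by (simp add: variation_density_eq[OF assms(1) x] op_variation_def)
  next
    case False
    then have x': "x \<in> minus_zero" using x zero_sets by blast
    have "Am \<phi>m x = Am \<phi> x"
      by (rule minus.op_cong[OF smooth(3,1) x open_zero_sets(2) x']) (simp add: \<phi>m_def)
    moreover have "Ap \<phi>p x = 0"
      by (rule plus.op_eq_0[OF smooth(2) x open_zero_sets(2) x'])
        (use zero_sets in \<open>auto simp: \<phi>p_def\<close>)
    moreover have "\<phi>m x = \<phi> x" "\<phi>p x = 0"
      using False x' by (auto simp: \<phi>p_def \<phi>m_def)
    moreover have "op_Lagrangian Am u x = 0" using x' by (simp add: minus_zero_def)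
    ultimately show ?thesis
      using Lagrangians_neq[OF x]
      by (simp add: variation_density_eq[OF assms(1) x] op_variation_def)
  qed
  note int = minus.integral_op_variation(2,3)[OF m smooth_u] plus.integral_op_variation(2,3)[OF p smooth_u]
  show "set_integrable lborel \<Omega> (variation_density (quotient_Lagrangian Ap Am) u \<phi>)"
    using set_integral_diff(1)[OF int(1,3)] eq by (simp cong: set_integrable_cong)
  have "(LINT x:\<Omega>|lborel. variation_density (quotient_Lagrangian Ap Am) u \<phi> x) =
      (LINT x:\<Omega>|lborel. op_variation Am u \<phi>m x - op_variation Ap u \<phi>p x)"
    by (rule set_lebesgue_integral_cong) (use eq plus.open_domain in auto)
  then show "(LINT x:\<Omega>|lborel. variation_density (quotient_Lagrangian Ap Am) u \<phi> x) =
      2 * (LINT x:\<Omega>|lborel. Re (hdot (\<phi>m x) (Am u x)))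
      - 2 * (LINT x:\<Omega>|lborel. Re (hdot (\<phi>p x) (Ap u x)))"
    using set_integral_diff(2)[OF int(1,3)] int(2,4) by simp
qed

end

text \<open>The splitting is available in both directions: the product of the Lagrangians vanishes
  by stationarity in one, and because \<open>A u x = 0\<close> annihilates
  \<open>op_Lagrangian A u x\<close> in the other.\<close>

lemma Euler_Lagrange_solution_iff:
  "Euler_Lagrange_solution \<Omega> (quotient_Lagrangian Ap Am) u \<longleftrightarrow>
    (\<forall>x\<in>\<Omega>. Ap u x = 0 \<or> Am u x = 0)" (is "?EL \<longleftrightarrow> ?sol")
proof
  assume EL: ?EL
  note zero = Euler_Lagrange_imp_product_eq_0[OF EL]
  have EL_0: "(LINT x:\<Omega>|lborel. variation_density (quotient_Lagrangian Ap Am) u \<phi> x) = 0"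
    if "test_function \<Omega> \<phi>" for \<phi>
    using EL that unfolding Euler_Lagrange_solution_def by blast
  have "Ap u x = 0" if "x \<in> plus_zero" for x
  proof (rule plus.weak_solution_imp_solution[OF smooth_u open_zero_sets(1)[OF zero] _ that])
    fix \<phi> :: "real ^ 'n \<Rightarrow> complex ^ 'm" assume \<phi>: "test_function plus_zero \<phi>"
    then have \<phi>': "test_function \<Omega> \<phi>"
      by (rule test_function_mono) (auto simp: plus_zero_def)
    obtain K where "compact K" "K \<subseteq> plus_zero" "\<And>x. x \<notin> K \<Longrightarrow> \<phi> x = 0"
      using test_function_compact_support[OF \<phi>] by blast
    \<comment> \<open>A variation supported in \<open>plus_zero\<close> has no part on
      \<open>minus_zero\<close>, so only the term with \<open>Ap\<close> survives.\<close>
    then have eq: "(if x \<in> plus_zero then \<phi> x else 0) = \<phi> x"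
      "(if x \<in> minus_zero then \<phi> x else 0) = 0" for x
      using zero_sets(2)[OF zero] by auto
    then show "(LINT x:\<Omega>|lborel. Re (hdot (\<phi> x) (Ap u x))) = 0"
      using first_variation(2)[OF zero \<phi>'] unfolding eq EL_0[OF \<phi>']
      by (simp add: set_lebesgue_integral_def)
  qed (auto simp: plus_zero_def)
  moreover have "Am u x = 0" if "x \<in> minus_zero" for x
  proof (rule minus.weak_solution_imp_solution[OF smooth_u open_zero_sets(2)[OF zero] _ that])
    fix \<phi> :: "real ^ 'n \<Rightarrow> complex ^ 'm" assume \<phi>: "test_function minus_zero \<phi>"
    then have \<phi>': "test_function \<Omega> \<phi>"
      by (rule test_function_mono) (auto simp: minus_zero_def)
    obtain K where "compact K" "K \<subseteq> minus_zero" "\<And>x. x \<notin> K \<Longrightarrow> \<phi> x = 0"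
      using test_function_compact_support[OF \<phi>] by blast
    then have eq: "(if x \<in> minus_zero then \<phi> x else 0) = \<phi> x"
      "(if x \<in> plus_zero then \<phi> x else 0) = 0" for x
      using zero_sets(2)[OF zero] by auto
    then show "(LINT x:\<Omega>|lborel. Re (hdot (\<phi> x) (Am u x))) = 0"
      using first_variation(2)[OF zero \<phi>'] unfolding eq EL_0[OF \<phi>']
      by (simp add: set_lebesgue_integral_def)
  qed (auto simp: minus_zero_def)
  ultimately show ?sol
    using zero_sets(1)[OF zero] by blast
next
  assume sol: ?sol
  then have zero: "op_Lagrangian Ap u x * op_Lagrangian Am u x = 0" if "x \<in> \<Omega>" for x
    using that by (auto simp: op_Lagrangian_def)
  \<comment> \<open>On \<open>plus_zero\<close> the Lagrangian of \<open>Am\<close> is nonzero,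
    hence so is \<open>Am u x\<close>, and the alternative leaves \<open>Ap u x = 0\<close>.\<close>
  have Ap: "Ap u x = 0" if "x \<in> plus_zero" for x
    using that sol Lagrangians_neq[of x] by (auto simp: plus_zero_def op_Lagrangian_def)
  have Am: "Am u x = 0" if "x \<in> minus_zero" for x
    using that sol Lagrangians_neq[of x] by (auto simp: minus_zero_def op_Lagrangian_def)
  show ?EL
    unfolding Euler_Lagrange_solution_def
  proof (intro allI impI conjI ballI)
    fix \<phi> :: "real ^ 'n \<Rightarrow> complex ^ 'm" assume \<phi>: "test_function \<Omega> \<phi>"
    show "(\<lambda>t. quotient_Lagrangian Ap Am (\<lambda>y. u y + t *\<^sub>R \<phi> y) x) differentiable at 0"
      if "x \<in> \<Omega>" for x
      using quotient_Lagrangian_derivative[OF \<phi> that] real_differentiable_def by blast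
    show "set_integrable lborel \<Omega> (variation_density (quotient_Lagrangian Ap Am) u \<phi>)"
      by (rule first_variation(1)[OF zero \<phi>])
    have Re_0: "Re (hdot (if x \<in> plus_zero then \<phi> x else 0) (Ap u x)) = 0"
      "Re (hdot (if x \<in> minus_zero then \<phi> x else 0) (Am u x)) = 0" for x
      using Ap Am by auto
    show "(LINT x:\<Omega>|lborel. variation_density (quotient_Lagrangian Ap Am) u \<phi> x) = 0"
      using first_variation(2)[OF zero \<phi>] unfolding Re_0 by (simp add: set_lebesgue_integral_def)
  qed
qed

text \<open>The choice could switch from point to point, but a connected \<open>K\<close> meets only
  one of the two disjoint open zero sets, and a point where \<open>Ap u\<close> or
  \<open>Am u\<close> is nonzero lies in the zero set of the other Lagrangian.\<close>

lemma pointwise_alternative_imp_solves_on: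
  assumes "\<forall>x\<in>\<Omega>. Ap u x = 0 \<or> Am u x = 0" "connected K" "K \<subseteq> \<Omega>"
  shows "solves_on K Ap u \<or> solves_on K Am u"
proof -
  have zero: "op_Lagrangian Ap u x * op_Lagrangian Am u x = 0" if "x \<in> \<Omega>" for x
    using that assms(1) by (auto simp: op_Lagrangian_def)
  have "plus_zero \<inter> K = {} \<or> minus_zero \<inter> K = {}"
    using connectedD[OF assms(2) open_zero_sets[OF zero]] zero_sets[OF zero] assms(3) by blast
  moreover have "x \<in> plus_zero" if "x \<in> \<Omega>" "Am u x \<noteq> 0" for x
    using that assms(1) by (auto simp: plus_zero_def op_Lagrangian_def)
  moreover have "x \<in> minus_zero" if "x \<in> \<Omega>" "Ap u x \<noteq> 0" for x
    using that assms(1) by (auto simp: minus_zero_def op_Lagrangian_def)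
  ultimately show ?thesis
    using assms(3) unfolding solves_on_def by blast
qed

end

theorem lemma1:
  fixes \<Omega> :: "(real ^ 'n) set"
    and Ap Am :: "(real ^ 'n \<Rightarrow> complex ^ 'm) \<Rightarrow> (real ^ 'n \<Rightarrow> complex ^ 'm)"
    and u :: "real ^ 'n \<Rightarrow> complex ^ 'm"
  assumes "open \<Omega>"
    and "first_order_diff_op \<Omega> Ap" and "formally_self_adjoint \<Omega> Ap"
    and "first_order_diff_op \<Omega> Am" and "formally_self_adjoint \<Omega> Am"
    and "smooth_on \<Omega> u"
    and "\<And>x. x \<in> \<Omega> \<Longrightarrow> op_Lagrangian Ap u x \<noteq> op_Lagrangian Am u x"
  shows "(Euler_Lagrange_solution \<Omega> (quotient_Lagrangian Ap Am) u \<longleftrightarrow>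
            (\<forall>K\<in>components \<Omega>. solves_on K Ap u \<or> solves_on K Am u)) \<and>
         (connected \<Omega> \<longrightarrow>
            (Euler_Lagrange_solution \<Omega> (quotient_Lagrangian Ap Am) u \<longleftrightarrow>
               solves_on \<Omega> Ap u \<or> solves_on \<Omega> Am u))"
proof -
  interpret symmetric_op_pair \<Omega> Ap Am u
    using assms by unfold_locales auto
  show ?thesis
    \<comment> \<open>Both equivalences become statements about the alternative at single points,
      each of which lies in a component.\<close>
    unfolding Euler_Lagrange_solution_iff
  proof (intro conjI impI iffI ballI)
    fix K assume "\<forall>x\<in>\<Omega>. Ap u x = 0 \<or> Am u x = 0" "K \<in> components \<Omega>"
    then show "solves_on K Ap u \<or> solves_on K Am u"
      by (intro pointwise_alternative_imp_solves_on in_components_connected in_components_subset)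
  next
    fix x assume K: "\<forall>K\<in>components \<Omega>. solves_on K Ap u \<or> solves_on K Am u" and "x \<in> \<Omega>"
    then obtain K where "K \<in> components \<Omega>" "x \<in> K"
      using Union_components by blast
    then show "Ap u x = 0 \<or> Am u x = 0"
      using K unfolding solves_on_def by blast
  next
    assume "connected \<Omega>" "\<forall>x\<in>\<Omega>. Ap u x = 0 \<or> Am u x = 0"
    then show "solves_on \<Omega> Ap u \<or> solves_on \<Omega> Am u"
      by (intro pointwise_alternative_imp_solves_on) auto
  next
    fix x assume "solves_on \<Omega> Ap u \<or> solves_on \<Omega> Am u" "x \<in> \<Omega>"
    then show "Ap u x = 0 \<or> Am u x = 0"
      unfolding solves_on_def by blast
  qed
qed

end
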